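(* For all integers $r\ge1$, $\pi_{3r}(rK_3)=\pi_3(K_3)=\frac{-1+\sqrt5}{2}$.
   Context: Graphs are finite and simple. An $m$-partite graph $G$ is a graph with a vertex partition $V = V_1\sqcup\dots\sqcup V_m$ into nonempty parts such that no edge has both ends in the same part. For disjoint nonempty vertex sets $X,Y$, the edge density is $d(X,Y) = \frac{e(X,Y)}{|X||Y|}$, where $e(X,Y)$ is the number of edges between $X$ and $Y$. The $m$-partite density of $G$ is $d_m(G) = \min_{1\le i<j\le m} d(V_i,V_j)$. A traversal of $G$ is a subgraph (on $m$ vertices) containing exactly one vertex from each part. For a graph $F$, $G$ contains an $F$-traversal if some traversal of $G$ contains $F$ as a subgraph (up to isomorphism). The critical density is $$\pi_m(F) = \sup\{\alpha\in[0,1] : \text{there exists an } m\text{-partite graph } G \text{ with } d_m(G)\ge\alpha \text{ and no } F\text{-traversal}\}.$$ $rK_3$ denotes the graph consisting of $r$ vertex-disjoint copies of the triangle $K_3$. *)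

theory Defs
  imports Complex_Main "HOL-Library.Disjoint_Sets"
begin

record 'a ugraph =
  verts :: "'a set"
  edges :: "'a set set"

definition simple_graph :: "'a ugraph \<Rightarrow> bool" where
  "simple_graph G \<longleftrightarrow> finite (verts G) \<and> (\<forall>e \<in> edges G. e \<subseteq> verts G \<and> card e = 2)"

definition subgraph :: "'a ugraph \<Rightarrow> 'a ugraph \<Rightarrow> bool" where
  "subgraph H G \<longleftrightarrow> simple_graph H \<and> simple_graph G \<and> verts H \<subseteq> verts G \<and> edges H \<subseteq> edges G"

definition graph_iso :: "'a ugraph \<Rightarrow> 'b ugraph \<Rightarrow> bool" where
  "graph_iso F H \<longleftrightarrow> (\<exists>f. bij_betw f (verts F) (verts H) \<and> (\<lambda>e. f ` e) ` edges F = edges H)"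

definition contains_copy :: "'a ugraph \<Rightarrow> 'b ugraph \<Rightarrow> bool" where
  "contains_copy G F \<longleftrightarrow> (\<exists>H. subgraph H G \<and> graph_iso F H)"

definition multipartite :: "nat \<Rightarrow> 'a ugraph \<Rightarrow> (nat \<Rightarrow> 'a set) \<Rightarrow> bool" where
  "multipartite m G V \<longleftrightarrow> simple_graph G
     \<and> verts G = (\<Union>i\<in>{1..m}. V i)
     \<and> disjoint_family_on V {1..m}
     \<and> (\<forall>i\<in>{1..m}. V i \<noteq> {})
     \<and> (\<forall>i\<in>{1..m}. \<forall>e\<in>edges G. \<not> e \<subseteq> V i)"

definition edges_between :: "'a ugraph \<Rightarrow> 'a set \<Rightarrow> 'a set \<Rightarrow> 'a set set" where
  "edges_between G X Y = {e \<in> edges G. \<exists>x\<in>X. \<exists>y\<in>Y. e = {x, y}}"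

definition edge_density :: "'a ugraph \<Rightarrow> 'a set \<Rightarrow> 'a set \<Rightarrow> real" where
  "edge_density G X Y = real (card (edges_between G X Y)) / (real (card X) * real (card Y))"

text \<open>The minimum is over a nonempty set only if \<open>m \<ge> 2\<close>; the value for \<open>m < 2\<close> is not
  meaningful.\<close>

definition partite_density :: "nat \<Rightarrow> 'a ugraph \<Rightarrow> (nat \<Rightarrow> 'a set) \<Rightarrow> real" where
  "partite_density m G V = Min {edge_density G (V i) (V j) | i j. 1 \<le> i \<and> i < j \<and> j \<le> m}"

definition traversal :: "nat \<Rightarrow> 'a ugraph \<Rightarrow> (nat \<Rightarrow> 'a set) \<Rightarrow> 'a ugraph \<Rightarrow> bool" where
  "traversal m G V T \<longleftrightarrow> subgraph T G \<and> (\<forall>i\<in>{1..m}. \<exists>!v. v \<in> verts T \<inter> V i)"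

definition has_traversal :: "nat \<Rightarrow> 'a ugraph \<Rightarrow> (nat \<Rightarrow> 'a set) \<Rightarrow> 'b ugraph \<Rightarrow> bool" where
  "has_traversal m G V F \<longleftrightarrow> (\<exists>T. traversal m G V T \<and> contains_copy T F)"

text \<open>Graphs being finite, it is no restriction to take their vertices in \<^typ>\<open>nat\<close>.\<close>

definition critical_density :: "nat \<Rightarrow> 'b ugraph \<Rightarrow> real" where
  "critical_density m F = Sup {\<alpha> \<in> {0..1}. \<exists>(G :: nat ugraph) V.
     multipartite m G V \<and> partite_density m G V \<ge> \<alpha> \<and> \<not> has_traversal m G V F}"

definition complete_graph :: "nat \<Rightarrow> nat ugraph" where
  "complete_graph n = \<lparr>verts = {1..n}, edges = {e. e \<subseteq> {1..n} \<and> card e = 2}\<rparr>"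

definition disjoint_copies :: "nat \<Rightarrow> 'a ugraph \<Rightarrow> (nat \<times> 'a) ugraph" where
  "disjoint_copies r F =
     \<lparr>verts = {1..r} \<times> verts F, edges = {{k} \<times> e | k e. k \<in> {1..r} \<and> e \<in> edges F}\<rparr>"

end

(* Write t for the positive root of t^2 = 1 - t.

   Upper bound: splitting the 3r parts into triples, it suffices to find a triangle between three
   parts X, Y, Z of pairwise density > t (Bondy, Shen, Thomasse, Thomasse).  For x in X let A(x), B(x)
   be its neighbourhoods in Y and Z, of relative sizes a(x), b(x).  The mean of the points (a(x), b(x))
   exceeds (t, t) in both coordinates, so some segment between two of the points, for x and x', meets
   the quadrant above (t, t).  This forces A(x) * B(x) united with A(x') * B(x') to cover at least
   1 - t = t^2 of Y * Z, so the union contains an edge, which closes a triangle.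

   Lower bound: let one part be a single vertex joined to a t-fraction N_i of every other part, and
   join two other parts completely except for the pairs in N_i * N_j.  Their density is 1 - t^2 = t, and
   the single vertex, which every rK_3 on 3r parts must use, lies in no triangle. *)

theory Submission
  imports Defs
begin

section \<open>The threshold density as the positive root of a quadratic\<close>

definition inv_golden :: real where
  "inv_golden = (- 1 + sqrt 5) / 2"

lemma inv_golden_square: "inv_golden * inv_golden = 1 - inv_golden"
  by (simp add: inv_golden_def field_simps)

lemma inv_golden_pos: "0 < inv_golden"
  by (simp add: inv_golden_def)

lemma inv_golden_less_1: "inv_golden < 1"
  using inv_golden_square inv_golden_pos by (smt (verit) mult_pos_pos)


section \<open>Triangles in dense tripartite graphs\<close>

text \<open>Multiply by \<tau> and write \<open>s * n + t * m\<close> as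
  \<open>(s - t) * n + t * (m + n)\<close>, where \<open>t \<le> s\<close> makes both coefficients
  nonnegative. The first term is bounded through \<open>n \<le> \<tau>\<close>, the second through
  the sign of \<open>(\<tau> - m) * (\<tau> - n)\<close>, which limits how large
  \<open>m + n\<close> can be for a given product.\<close>

lemma cross_term_bound_ordered:
  fixes \<tau> s t m n :: real
  assumes \<tau>: "0 < \<tau>" "\<tau> * \<tau> = 1 - \<tau>"
    and st: "0 \<le> t" "t \<le> s" "s \<le> 1 - \<tau>"
    and mn: "m \<le> \<tau>" "n \<le> \<tau>" "m * n \<le> s * t"
  shows "s * n + t * m + m * n \<le> \<tau> * (s + t)"
proof -
  have "0 \<le> (\<tau> - m) * (\<tau> - n)"
    using mn by simp
  then have chord: "\<tau> * (m + n) \<le> \<tau> * \<tau> + s * t"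
    using mn(3) by (simp add: algebra_simps)
  have "\<tau> * (s * n + t * m + m * n) = (s - t) * (\<tau> * n) + t * (\<tau> * (m + n)) + \<tau> * (m * n)"
    by (simp add: algebra_simps)
  also have "\<dots> \<le> (s - t) * (\<tau> * \<tau>) + t * (\<tau> * \<tau> + s * t) + \<tau> * (s * t)"
    using \<tau> st mn chord by (intro add_mono mult_left_mono) auto
  also have "\<dots> = s * (\<tau> * \<tau>) + t * (s * (t + \<tau>))"
    by (simp add: algebra_simps)
  \<comment> \<open>Both \<open>s \<le> 1 - \<tau>\<close> and \<open>t + \<tau> \<le> 1\<close>
    enter here. Since \<open>1 - \<tau>\<close> is \<open>\<tau> * \<tau>\<close>, the coefficients
    of \<open>s\<close> and \<open>t\<close> then agree.\<close>
  also have "\<dots> \<le> s * (\<tau> * \<tau>) + t * ((1 - \<tau>) * 1)"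
    using \<tau> st by (intro add_left_mono mult_left_mono mult_mono) auto
  also have "\<dots> = \<tau> * (\<tau> * (s + t))"
    by (simp flip: \<tau>(2) add: algebra_simps)
  finally show ?thesis
    using \<tau>(1) by simp
qed

lemma cross_term_bound:
  fixes \<tau> s t m n :: real
  assumes "0 < \<tau>" "\<tau> * \<tau> = 1 - \<tau>"
    and "0 \<le> s" "0 \<le> t" "s \<le> 1 - \<tau>" "t \<le> 1 - \<tau>"
    and "m \<le> \<tau>" "n \<le> \<tau>" "m * n \<le> s * t"
  shows "s * n + t * m + m * n \<le> \<tau> * (s + t)"
proof (cases "t \<le> s")
  case True
  then show ?thesis
    using assms by (intro cross_term_bound_ordered) auto
next
  case False
  \<comment> \<open>Exchanging \<open>s\<close> with \<open>t\<close> and \<open>m\<close> with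
    \<open>n\<close> simultaneously preserves the claim.\<close>
  then have "t * m + s * n + n * m \<le> \<tau> * (t + s)"
    using assms by (intro cross_term_bound_ordered) (auto simp: mult.commute)
  then show ?thesis
    by (simp add: algebra_simps)
qed

text \<open>Substitute the deviations from \<tau>: \<open>s = a1 - \<tau>\<close>,
  \<open>t = b2 - \<tau>\<close>, \<open>m = \<tau> - a2\<close>, \<open>n = \<tau> - b1\<close>.
  The right-hand side becomes \<open>\<tau> * \<tau>\<close> plus the slack in
  \<open>cross_term_bound\<close>. The last hypothesis says that the segment from
  \<open>(a1, b1)\<close> to \<open>(a2, b2)\<close> does not pass below
  \<open>(\<tau>, \<tau>)\<close>.\<close>

lemma two_rectangles_bound:
  fixes \<tau> a1 b1 a2 b2 :: real
  assumes "0 < \<tau>" "\<tau> * \<tau> = 1 - \<tau>"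
    and "\<tau> \<le> a1" "a1 \<le> 1" "\<tau> \<le> b2" "b2 \<le> 1" "0 \<le> a2" "a2 \<le> \<tau>" "0 \<le> b1" "b1 \<le> \<tau>"
    and "(\<tau> - a2) * (\<tau> - b1) \<le> (a1 - \<tau>) * (b2 - \<tau>)"
  shows "1 - \<tau> \<le> a1 * b1 + a2 * (b2 - b1)"
proof -
  have "(a1 - \<tau>) * (\<tau> - b1) + (b2 - \<tau>) * (\<tau> - a2) + (\<tau> - a2) * (\<tau> - b1)
      \<le> \<tau> * ((a1 - \<tau>) + (b2 - \<tau>))"
    using assms by (intro cross_term_bound) auto
  then show ?thesis
    by (simp flip: assms(2) add: algebra_simps)
qed

text \<open>In geometric terms: the mean of the points \<open>(u x, v x)\<close> lies in the open positive quadrant, so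
  one of the points or a segment between two of them meets the closed positive quadrant.\<close>

lemma dominating_segment:
  fixes u v :: "'a \<Rightarrow> real"
  assumes "finite X" "0 < sum u X" "0 < sum v X"
  obtains (point) x where "x \<in> X" "0 \<le> u x" "0 \<le> v x"
  | (segment) x y where "x \<in> X" "y \<in> X" "0 < u x" "v x < 0" "u y < 0" "0 < v y"
      "u y * v x \<le> u x * v y"
proof (cases "\<exists>x\<in>X. 0 \<le> u x \<and> 0 \<le> v x")
  case True
  then show ?thesis using point by blast
next
  case False
  define R where "R = {x \<in> X. 0 < u x}"
  have "R \<noteq> {}"
    using assms(2) sum_nonpos[of X u] by (force simp: R_def)
  moreover have "finite R"
    using assms(1) by (simp add: R_def)
  \<comment> \<open>Among the points to the right of the vertical axis, all of which lie below the
    horizontal one, \<open>x\<close> is the one whose direction from the origin is least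
    steep.\<close>
  ultimately obtain x where x: "x \<in> R" and min: "\<And>y. y \<in> R \<Longrightarrow> - v x / u x \<le> - v y / u y"
    using ex_min_if_finite[of "(\<lambda>x. - v x / u x) ` R"] by (fastforce simp: not_less)
  define c where "c = - v x / u x"
  have ux: "0 < u x" "x \<in> X" and vx: "v x < 0"
    using x False by (auto simp: R_def not_le)
  have c: "0 < c" "c * u x = - v x"
    using ux vx by (auto simp: c_def divide_neg_pos)
  \<comment> \<open>The functional \<open>v + c * u\<close> vanishes at \<open>x\<close> and has
    positive sum, so it is positive at some \<open>y\<close>. By the choice of \<open>x\<close> it
    is nonpositive wherever \<open>u\<close> is positive, which forces \<open>y\<close> to the other
    side.\<close>
  have "0 < sum v X + c * sum u X"
    using assms c by (simp add: add_pos_pos)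
  also have "\<dots> = (\<Sum>y\<in>X. v y + c * u y)"
    by (simp add: sum.distrib sum_distrib_left)
  finally obtain y where y: "y \<in> X" "0 < v y + c * u y"
    using sum_nonpos[of X "\<lambda>y. v y + c * u y"] by force
  have "\<not> 0 < u y"
  proof
    assume "0 < u y"
    then have "c \<le> - v y / u y"
      using min[of y] y by (simp add: R_def c_def)
    then show False
      using \<open>0 < u y\<close> y(2) by (simp add: field_simps)
  qed
  then have uy: "u y < 0"
    using False y c by (cases "u y = 0") auto
  then have vy: "0 < v y"
    using y(2) c(1) by (smt (verit) mult_pos_neg)
  have "v x = - (c * u x)"
    using c(2) by simp
  then have "u y * v x = - (c * u y) * u x"
    by simp
  also have "\<dots> \<le> v y * u x"
    using y(2) ux by (intro mult_right_mono) auto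
  finally show ?thesis
    using segment ux vx uy vy y by (simp add: mult.commute)
qed

text \<open>Inclusion-exclusion, with the overlap enclosed in \<open>A2 \<times> B1\<close>. In the
  application these are the sides of relative size below the threshold, which makes the estimate
  good enough.\<close>

lemma card_Un_Times_ge:
  assumes "finite A1" "finite A2" "finite B1" "finite B2"
  shows "card A1 * card B1 + card A2 * card B2
    \<le> card (A1 \<times> B1 \<union> A2 \<times> B2) + card A2 * card B1"
proof -
  have "card (A1 \<times> B1) + card (A2 \<times> B2)
      = card (A1 \<times> B1 \<union> A2 \<times> B2) + card (A1 \<times> B1 \<inter> A2 \<times> B2)"
    using assms by (intro card_Un_Int) auto
  moreover have "card (A1 \<times> B1 \<inter> A2 \<times> B2) \<le> card (A2 \<times> B1)"
    using assms by (intro card_mono) auto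
  ultimately show ?thesis
    by (simp add: card_cartesian_product)
qed

lemma card_relation_eq_sum:
  assumes "finite X" "finite Y"
  shows "card {(x, y) \<in> X \<times> Y. P x y} = (\<Sum>x\<in>X. card {y \<in> Y. P x y})"
proof -
  have "{(x, y) \<in> X \<times> Y. P x y} = (SIGMA x:X. {y \<in> Y. P x y})"
    by auto
  then show ?thesis
    using assms by simp
qed

text \<open>Double counting turns a density above \<tau> into a positive sum of deviations, the form
  in which \<open>dominating_segment\<close> takes it.\<close>

lemma sum_degree_excess:
  fixes \<tau> :: real
  assumes "finite X" "finite Y" "Y \<noteq> {}"
    and "\<tau> * (card X * card Y) < card {(x, y) \<in> X \<times> Y. P x y}"
  shows "0 < (\<Sum>x\<in>X. card {y \<in> Y. P x y} / card Y - \<tau>)"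
proof -
  have "0 < real (card Y)"
    using assms by (simp add: card_gt_0_iff)
  moreover have "(\<Sum>x\<in>X. card {y \<in> Y. P x y} / card Y - \<tau>)
      = real (card {(x, y) \<in> X \<times> Y. P x y}) / card Y - card X * \<tau>"
    unfolding card_relation_eq_sum[OF assms(1,2)] by (simp add: sum_subtractf sum_divide_distrib)
  ultimately show ?thesis
    using assms(4) by (simp add: pos_less_divide_eq mult_ac)
qed

lemma ex_triangle_if_dense:
  fixes P :: "'a \<Rightarrow> 'b \<Rightarrow> bool" and Q :: "'a \<Rightarrow> 'c \<Rightarrow> bool" and R :: "'b \<Rightarrow> 'c \<Rightarrow> bool"
  assumes fin: "finite X" "finite Y" "finite Z" and ne: "Y \<noteq> {}" "Z \<noteq> {}"
    and P: "inv_golden * (card X * card Y) < card {(x, y) \<in> X \<times> Y. P x y}"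
    and Q: "inv_golden * (card X * card Z) < card {(x, z) \<in> X \<times> Z. Q x z}"
    and R: "inv_golden * (card Y * card Z) < card {(y, z) \<in> Y \<times> Z. R y z}"
  shows "\<exists>x\<in>X. \<exists>y\<in>Y. \<exists>z\<in>Z. P x y \<and> Q x z \<and> R y z"
proof (rule ccontr)
  assume no_triangle: "\<not> ?thesis"
  define A where "A x = {y \<in> Y. P x y}" for x
  define B where "B x = {z \<in> Z. Q x z}" for x
  define a where "a x = card (A x) / card Y" for x
  define b where "b x = card (B x) / card Z" for x
  define \<tau> where "\<tau> = inv_golden"
  note \<tau> = inv_golden_pos[folded \<tau>_def] inv_golden_square[folded \<tau>_def]
  have pos: "0 < real (card Y)" "0 < real (card Z)"
    using fin ne by (simp_all add: card_gt_0_iff)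
  have fin_AB: "finite (A x)" "finite (B x)" for x
    using fin by (simp_all add: A_def B_def)
  have le_1: "a x \<le> 1" "b x \<le> 1" for x
    using pos fin by (auto simp: a_def b_def A_def B_def intro!: card_mono)
  have nonneg: "0 \<le> a x" "0 \<le> b x" for x
    by (simp_all add: a_def b_def)
  have card_eq: "real (card (A x)) = a x * card Y" "real (card (B x)) = b x * card Z" for x
    using pos by (simp_all add: a_def b_def)
  \<comment> \<open>Without a triangle, the edges between \<open>Y\<close> and \<open>Z\<close>
    avoid both neighbourhood rectangles, which therefore share less than \<open>1 - \<tau>\<close>
    of all pairs. The case \<open>x = y\<close> serves for a single dominating point.\<close>
  have upper: "a x * b x + a y * (b y - b x) < 1 - \<tau>" if "x \<in> X" "y \<in> X" for x y
  proof -
    let ?E = "{(y, z) \<in> Y \<times> Z. R y z}" and ?U = "A x \<times> B x \<union> A y \<times> B y"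
    have "card ?E + card ?U = card (?E \<union> ?U)"
      using no_triangle that fin fin_AB
      by (intro card_Un_disjoint[symmetric]) (auto simp: A_def B_def intro: finite_subset[of _ "Y \<times> Z"])
    also have "\<dots> \<le> card (Y \<times> Z)"
      using fin by (intro card_mono) (auto simp: A_def B_def)
    finally have "card ?E + card ?U \<le> card Y * card Z"
      by (simp add: card_cartesian_product)
    then have "card ?E + card (A x) * card (B x) + card (A y) * card (B y)
        \<le> card Y * card Z + card (A y) * card (B x)"
      using card_Un_Times_ge[OF fin_AB(1)[of x] fin_AB(1)[of y] fin_AB(2)[of x] fin_AB(2)[of y]]
      by linarith
    then have "card ?E + real (card (A x)) * card (B x) + real (card (A y)) * card (B y)
        \<le> real (card Y) * card Z + real (card (A y)) * card (B x)"
      by (simp flip: of_nat_mult of_nat_add)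
    then have "\<tau> * (real (card Y) * card Z) + (a x * b x + a y * b y) * (real (card Y) * card Z)
        < (1 + a y * b x) * (real (card Y) * card Z)"
      using R by (simp add: card_eq \<tau>_def algebra_simps)
    then have "(\<tau> + (a x * b x + a y * b y)) * (real (card Y) * card Z)
        < (1 + a y * b x) * (real (card Y) * card Z)"
      by (simp add: algebra_simps)
    then have "\<tau> + (a x * b x + a y * b y) < 1 + a y * b x"
      using pos by (metis mult_less_cancel_right_pos mult_pos_pos)
    then show ?thesis
      by (simp add: algebra_simps)
  qed
  have "0 < (\<Sum>x\<in>X. a x - \<tau>)" "0 < (\<Sum>x\<in>X. b x - \<tau>)"
    using sum_degree_excess[OF fin(1,2) ne(1) P] sum_degree_excess[OF fin(1,3) ne(2) Q]
    by (simp_all add: a_def b_def A_def B_def \<tau>_def)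
  from fin(1) this show False
  proof (cases rule: dominating_segment)
    case (point x)
    then have "\<tau> * \<tau> \<le> a x * b x"
      using \<tau> by (intro mult_mono) auto
    then show False
      using upper[of x x] point \<tau> by simp
  next
    case (segment x y)
    then have "1 - \<tau> \<le> a x * b x + a y * (b y - b x)"
      using \<tau> le_1 nonneg by (intro two_rectangles_bound) (auto simp: algebra_simps)
    then show False
      using upper[of x y] segment by simp
  qed
qed


section \<open>Densities above the threshold\<close>

text \<open>Disjointness lets an edge determine which of its ends lies in \<open>X\<close>, so
  unordered edges can be counted as ordered pairs.\<close>

lemma card_edges_between:
  assumes "X \<inter> Y = {}"
  shows "card (edges_between G X Y) = card {(x, y) \<in> X \<times> Y. {x, y} \<in> edges G}"
proof -
  have "bij_betw (\<lambda>(x, y). {x, y}) {(x, y) \<in> X \<times> Y. {x, y} \<in> edges G} (edges_between G X Y)"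
    using assms by (auto simp: bij_betw_def inj_on_def edges_between_def doubleton_eq_iff)
  then show ?thesis
    by (rule bij_betw_same_card[symmetric])
qed

section \<open>From the minimum density to individual pairs of parts\<close>

lemma finite_density_set: "finite {edge_density G (V i) (V j) | i j. 1 \<le> i \<and> i < j \<and> j \<le> (m::nat)}"
  by (rule finite_subset[of _ "(\<lambda>(i, j). edge_density G (V i) (V j)) ` ({1..m} \<times> {1..m})"]) auto

lemma partite_density_le:
  assumes "1 \<le> i" "i < j" "j \<le> m"
  shows "partite_density m G V \<le> edge_density G (V i) (V j)"
  unfolding partite_density_def using assms finite_density_set by (intro Min_le) auto

lemma le_partite_density:
  assumes "2 \<le> m"
    and "\<And>i j. 1 \<le> i \<Longrightarrow> i < j \<Longrightarrow> j \<le> m \<Longrightarrow> \<alpha> \<le> edge_density G (V i) (V j)"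
  shows "\<alpha> \<le> partite_density m G V"
proof -
  \<comment> \<open>This element shows that the minimum is taken over a nonempty set.\<close>
  have "edge_density G (V 1) (V 2) \<in> {edge_density G (V i) (V j) | i j. 1 \<le> i \<and> i < j \<and> j \<le> m}"
    using assms(1) by force
  then show ?thesis
    unfolding partite_density_def using finite_density_set assms(2)
    by (subst Min_ge_iff) auto
qed

lemma multipartite_finite_part:
  assumes "multipartite m G V" "i \<in> {1..m}"
  shows "finite (V i)"
  using assms by (auto simp: multipartite_def simple_graph_def intro: finite_subset)

lemma multipartite_parts_disjoint:
  assumes "multipartite m G V" "i \<in> {1..m}" "j \<in> {1..m}" "i \<noteq> j"
  shows "V i \<inter> V j = {}"
  using assms unfolding multipartite_def disjoint_family_on_def by blast

lemma multipartite_triangle: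
  assumes G: "multipartite m G V" and dense: "inv_golden < partite_density m G V"
    and ijk: "1 \<le> i" "i < j" "j < k" "k \<le> m"
  shows "\<exists>x\<in>V i. \<exists>y\<in>V j. \<exists>z\<in>V k. {x, y} \<in> edges G \<and> {x, z} \<in> edges G \<and> {y, z} \<in> edges G"
proof -
  have part: "finite (V p)" "V p \<noteq> {}" if "p \<in> {i, j, k}" for p
    using G ijk that multipartite_finite_part[OF G, of p] by (auto simp: multipartite_def)
  have count: "inv_golden * (card (V p) * card (V q)) < card {(x, y) \<in> V p \<times> V q. {x, y} \<in> edges G}"
    if "p \<in> {i, j, k}" "q \<in> {i, j, k}" "p < q" for p q
  proof -
    have "V p \<inter> V q = {}"
      using ijk that by (intro multipartite_parts_disjoint[OF G]) auto
    moreover have "inv_golden < edge_density G (V p) (V q)"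
      using dense partite_density_le[of p q m G V] ijk that by auto
    moreover have "0 < real (card (V p)) * real (card (V q))"
      using part that by (simp add: card_gt_0_iff)
    ultimately show ?thesis
      by (simp add: edge_density_def card_edges_between pos_less_divide_eq)
  qed
  show ?thesis
    using part count ijk by (intro ex_triangle_if_dense) auto
qed

section \<open>Assembling triangles into a traversal\<close>

lemma simple_graph_disjoint_copies_complete:
  "simple_graph (disjoint_copies r (complete_graph n))"
  by (auto simp: simple_graph_def disjoint_copies_def complete_graph_def card_cartesian_product)

lemma card_2_subset_triple:
  assumes "e \<subseteq> {1..3::nat}" "card e = 2"
  shows "e = {1, 2} \<or> e = {1, 3} \<or> e = {2, 3}"
proof -
  obtain x y where "e = {x, y}" "x \<noteq> y"
    using assms(2) by (auto simp: card_2_iff)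
  moreover have "x \<in> {1, 2, 3}" "y \<in> {1, 2, 3}"
    using assms(1) calculation by auto
  ultimately show ?thesis
    by auto
qed

text \<open>Since \<sigma> is injective and the parts are disjoint, \<open>f\<close> is injective.
  Since \<sigma> is onto, the image of \<open>F\<close> meets every part exactly once, so this image
  serves both as the traversal and as the copy of \<open>F\<close>.\<close>

lemma has_traversal_if_transversal_embedding:
  assumes G: "multipartite m G V" and F: "simple_graph F"
    and \<sigma>: "bij_betw \<sigma> (verts F) {1..m}"
    and f: "\<And>x. x \<in> verts F \<Longrightarrow> f x \<in> V (\<sigma> x)"
    and E: "\<And>e. e \<in> edges F \<Longrightarrow> f ` e \<in> edges G"
  shows "has_traversal m G V F"
proof -
  have \<sigma>_mem: "\<sigma> x \<in> {1..m}" if "x \<in> verts F" for x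
    using \<sigma> that by (auto simp: bij_betw_def)
  have same_part: "i = j" if "v \<in> V i" "v \<in> V j" "i \<in> {1..m}" "j \<in> {1..m}" for v i j
    using multipartite_parts_disjoint[OF G that(3,4)] that(1,2) by blast
  have inj: "inj_on f (verts F)"
    using \<sigma> f \<sigma>_mem same_part unfolding inj_on_def bij_betw_def by metis
  have simple: "simple_graph G"
    using G by (simp add: multipartite_def)
  let ?T = "\<lparr>verts = f ` verts F, edges = (`) f ` edges F\<rparr>"
  have "simple_graph ?T"
    using F E simple by (auto simp: simple_graph_def dest: E)
  moreover have "f ` verts F \<subseteq> verts G"
    using f \<sigma>_mem G by (fastforce simp: multipartite_def)
  ultimately have "subgraph ?T G"
    using simple E by (auto simp: subgraph_def)
  moreover have "\<exists>!v. v \<in> verts ?T \<inter> V i" if i: "i \<in> {1..m}" for i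
  proof -
    obtain x where x: "x \<in> verts F" "\<sigma> x = i"
      using \<sigma> i by (metis bij_betw_iff_bijections)
    have "v = f x" if v: "v \<in> verts ?T \<inter> V i" for v
    proof -
      obtain y where y: "y \<in> verts F" "v = f y"
        using v by auto
      then have "\<sigma> y = i"
        using v i f \<sigma>_mem same_part by blast
      then show ?thesis
        using \<sigma> x y by (auto simp: bij_betw_def inj_on_def)
    qed
    then show ?thesis
      using x f[of x] by (intro ex1I[of _ "f x"]) auto
  qed
  ultimately have "traversal m G V ?T"
    by (simp add: traversal_def)
  moreover have "contains_copy ?T F"
    unfolding contains_copy_def graph_iso_def
    using \<open>simple_graph ?T\<close> inj by (intro exI[of _ ?T]) (auto simp: subgraph_def bij_betw_def)
  ultimately show ?thesis
    by (auto simp: has_traversal_def)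
qed

lemma bij_betw_triples:
  "bij_betw (\<lambda>(k, j). 3 * (k - 1) + j) ({1..r} \<times> {1..3::nat}) {1..3 * r}"
\<comment> \<open>Copies, vertices and parts are all numbered from 1, hence the shifts around
  division with remainder.\<close>
proof (rule bij_betw_byWitness[where f' = "\<lambda>i. ((i - 1) div 3 + 1, (i - 1) mod 3 + 1)"])
  show "\<forall>x\<in>{1..r} \<times> {1..3}. (\<lambda>i. ((i - 1) div 3 + 1, (i - 1) mod 3 + 1))
      ((\<lambda>(k, j). 3 * (k - 1) + j) x) = x"
  proof
    fix x assume "x \<in> {1..r} \<times> {1..3::nat}"
    then obtain k j where kj: "x = (k, j)" "k \<in> {1..r}" "j \<in> {1..3}"
      by blast
    then have "3 * (k - 1) + j - 1 = (j - 1) + (k - 1) * 3" "j - 1 < 3"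
      by auto
    then have "(3 * (k - 1) + j - 1) div 3 = k - 1" "(3 * (k - 1) + j - 1) mod 3 = j - 1"
      by simp_all
    then show "(\<lambda>i. ((i - 1) div 3 + 1, (i - 1) mod 3 + 1)) ((\<lambda>(k, j). 3 * (k - 1) + j) x) = x"
      using kj by simp
  qed
qed auto

text \<open>The \<open>k\<close>-th triangle is chosen in the \<open>k\<close>-th block of three
  consecutive parts. Different blocks share no part, so the choices are independent.\<close>

lemma has_traversal_triangles_if_dense:
  assumes G: "multipartite (3 * r) G V" and dense: "inv_golden < partite_density (3 * r) G V"
  shows "has_traversal (3 * r) G V (disjoint_copies r (complete_graph 3))"
proof -
  have "\<exists>x y z. x \<in> V (3 * (k - 1) + 1) \<and> y \<in> V (3 * (k - 1) + 2) \<and> z \<in> V (3 * (k - 1) + 3)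
      \<and> {x, y} \<in> edges G \<and> {x, z} \<in> edges G \<and> {y, z} \<in> edges G" if "k \<in> {1..r}" for k
  proof -
    have "3 * (k - 1) + 3 \<le> 3 * r"
      using that by auto
    then have "\<exists>x\<in>V (3 * (k - 1) + 1). \<exists>y\<in>V (3 * (k - 1) + 2). \<exists>z\<in>V (3 * (k - 1) + 3).
        {x, y} \<in> edges G \<and> {x, z} \<in> edges G \<and> {y, z} \<in> edges G"
      by (intro multipartite_triangle[OF G dense]) auto
    then show ?thesis
      by blast
  qed
  then obtain x y z where xyz: "\<And>k. k \<in> {1..r} \<Longrightarrow>
      x k \<in> V (3 * (k - 1) + 1) \<and> y k \<in> V (3 * (k - 1) + 2) \<and> z k \<in> V (3 * (k - 1) + 3)
      \<and> {x k, y k} \<in> edges G \<and> {x k, z k} \<in> edges G \<and> {y k, z k} \<in> edges G"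
    by metis
  define f where "f = (\<lambda>(k, j::nat). if j = 1 then x k else if j = 2 then y k else z k)"
  show ?thesis
  proof (rule has_traversal_if_transversal_embedding[OF G simple_graph_disjoint_copies_complete])
    show "bij_betw (\<lambda>(k, j). 3 * (k - 1) + j) (verts (disjoint_copies r (complete_graph 3))) {1..3 * r}"
      using bij_betw_triples by (simp add: disjoint_copies_def complete_graph_def)
  next
    fix p assume "p \<in> verts (disjoint_copies r (complete_graph 3))"
    then obtain k j where kj: "p = (k, j)" "k \<in> {1..r}" "j \<in> {1..3}"
      by (auto simp: disjoint_copies_def complete_graph_def)
    then have "j = 1 \<or> j = 2 \<or> j = 3"
      by auto
    then show "f p \<in> V ((\<lambda>(k, j). 3 * (k - 1) + j) p)"
      using xyz[OF kj(2)] kj(1) by (auto simp: f_def)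
  next
    fix e assume "e \<in> edges (disjoint_copies r (complete_graph 3))"
    then obtain k e' where e: "e = {k} \<times> e'" "k \<in> {1..r}" "e' \<subseteq> {1..3}" "card e' = 2"
      by (auto simp: disjoint_copies_def complete_graph_def)
    show "f ` e \<in> edges G"
      using card_2_subset_triple[OF e(3,4)] xyz[OF e(2)] e(1) by (auto simp: f_def)
  qed
qed


section \<open>A dense graph with a vertex in no triangle\<close>

text \<open>Vertex \<open>0\<close> is the only vertex of part \<open>1\<close>; for \<open>i \<ge> 2\<close>, part \<open>i\<close> consists of the numbers
  \<open>x\<close> with \<open>x div n = i\<close>, and those with \<open>x mod n < a\<close> are the neighbours of \<open>0\<close>.\<close>

definition star_part :: "nat \<Rightarrow> nat \<Rightarrow> nat set" where
  "star_part n i = (if i = 1 then {0} else {n * i..<n * i + n})"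

definition star_adj :: "nat \<Rightarrow> nat \<Rightarrow> nat \<Rightarrow> nat \<Rightarrow> bool" where
  "star_adj n a x y \<longleftrightarrow>
     (if x = 0 then y \<noteq> 0 \<and> y mod n < a
      else if y = 0 then x mod n < a
      else x div n \<noteq> y div n \<and> \<not> (x mod n < a \<and> y mod n < a))"

definition star_graph :: "nat \<Rightarrow> nat \<Rightarrow> nat \<Rightarrow> nat ugraph" where
  "star_graph m n a = \<lparr>verts = (\<Union>i\<in>{1..m}. star_part n i),
     edges = {{x, y} | x y. x \<in> (\<Union>i\<in>{1..m}. star_part n i) \<and> y \<in> (\<Union>i\<in>{1..m}. star_part n i)
       \<and> star_adj n a x y}\<rparr>"

lemma star_adj_commute: "star_adj n a x y \<longleftrightarrow> star_adj n a y x"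
  by (auto simp: star_adj_def)

lemma star_graph_edge_iff:
  "{x, y} \<in> edges (star_graph m n a) \<longleftrightarrow>
     x \<in> verts (star_graph m n a) \<and> y \<in> verts (star_graph m n a) \<and> star_adj n a x y"
  using star_adj_commute[of n a x y] by (auto simp: star_graph_def doubleton_eq_iff)

text \<open>Reduces membership to the arithmetic used by \<open>star_adj\<close>; vertex 0 has
  quotient 0 and so falls outside all these parts.\<close>

lemma star_part_iff:
  assumes "0 < n" "2 \<le> i"
  shows "x \<in> star_part n i \<longleftrightarrow> x \<noteq> 0 \<and> x div n = i"
proof -
  have "x \<in> star_part n i \<longleftrightarrow> x div n = i"
    using assms by (auto simp: star_part_def div_nat_eqI dividend_less_times_div
        intro: div_nat_eqI times_div_less_eq_dividend)
      (metis add.commute dividend_less_div_times mult.commute)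
  then show ?thesis
    using assms by (cases "x = 0") auto
qed

lemma star_part_1: "star_part n (Suc 0) = {0}"
  by (simp add: star_part_def)

lemma multipartite_star_graph:
  assumes "0 < n"
  shows "multipartite m (star_graph m n a) (star_part n)"
proof -
  have same_part: "\<not> star_adj n a x y" if "x \<in> star_part n i" "y \<in> star_part n i" "1 \<le> i" for x y i
    using that assms star_part_iff[of n i] by (cases "i = 1") (auto simp: star_adj_def star_part_1)
  have "e \<subseteq> verts (star_graph m n a) \<and> card e = 2" if e: "e \<in> edges (star_graph m n a)" for e
  proof -
    obtain x y where xy: "e = {x, y}" "star_adj n a x y"
      using e by (auto simp: star_graph_def)
    then have "x \<noteq> y"
      by (auto simp: star_adj_def split: if_splits)
    then show ?thesis
      using e xy by (simp add: star_graph_edge_iff)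
  qed
  then have "simple_graph (star_graph m n a)"
    by (simp add: simple_graph_def) (simp add: star_graph_def star_part_def)
  moreover have "disjoint_family_on (star_part n) {1..m}"
    unfolding disjoint_family_on_def
  proof (intro ballI impI)
    fix i j assume "i \<in> {1..m}" "j \<in> {1..m}" "i \<noteq> j"
    then show "star_part n i \<inter> star_part n j = {}"
      using assms star_part_iff[of n i] star_part_iff[of n j]
      by (cases "i = 1"; cases "j = 1") (auto simp: star_part_1)
  qed
  moreover have "\<not> e \<subseteq> star_part n i" if "i \<in> {1..m}" "e \<in> edges (star_graph m n a)" for i e
    using that same_part by (auto simp: star_graph_def)
  ultimately show ?thesis
    using assms by (auto simp: multipartite_def star_graph_def star_part_def)
qed

lemma star_part_mod_less:
  assumes "0 < n" "2 \<le> i" "a \<le> n"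
  shows "{x \<in> star_part n i. x mod n < a} = {n * i..<n * i + a}"
proof -
  have "x mod n = x - n * i" if "x \<in> star_part n i" for x
    using that assms star_part_iff[of n i x] by (metis minus_mult_div_eq_mod)
  then show ?thesis
    using assms by (force simp: star_part_def)
qed

text \<open>The single vertex of part 1 has \<open>a\<close> neighbours among the \<open>n\<close>
  vertices of part \<open>j\<close>. Between two later parts, exactly the \<open>a * a\<close> pairs
  of neighbours of 0 are missing.\<close>

lemma edge_density_star_graph:
  assumes "0 < n" "a \<le> n" "1 \<le> i" "i < j" "j \<le> m"
  shows "edge_density (star_graph m n a) (star_part n i) (star_part n j)
    = (if i = 1 then a / n else 1 - (a / n)\<^sup>2)"
proof -
  let ?G = "star_graph m n a"
  let ?N = "\<lambda>i. {x \<in> star_part n i. x mod n < a}"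
  have disj: "star_part n i \<inter> star_part n j = {}"
    using assms by (intro multipartite_parts_disjoint[OF multipartite_star_graph[OF assms(1), of m a]]) auto
  have sub: "star_part n i \<subseteq> verts ?G" "star_part n j \<subseteq> verts ?G"
    using assms by (fastforce simp: star_graph_def)+
  have card: "card (star_part n k) = n" "card (?N k) = a" if "2 \<le> k" for k
    using that assms star_part_mod_less[of n k a] by (simp_all add: star_part_def)
  show ?thesis
  proof (cases "i = 1")
    case True
    have "{(x, y) \<in> star_part n i \<times> star_part n j. {x, y} \<in> edges ?G} = {0} \<times> ?N j"
      using sub True assms star_part_iff[of n j]
      by (auto simp: star_graph_edge_iff star_part_1 star_adj_def)
    then show ?thesis
      using True assms card[of j] disj
      by (simp add: edge_density_def card_edges_between card_cartesian_product star_part_1)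
  next
    case False
    have "{(x, y) \<in> star_part n i \<times> star_part n j. {x, y} \<in> edges ?G}
        = star_part n i \<times> star_part n j - ?N i \<times> ?N j"
      using sub False assms star_part_iff[of n i] star_part_iff[of n j]
      by (auto simp: star_graph_edge_iff star_adj_def)
    moreover have "card (star_part n i \<times> star_part n j - ?N i \<times> ?N j) = n * n - a * a"
      using False assms card[of i] card[of j]
      by (subst card_Diff_subset) (auto simp: card_cartesian_product star_part_def)
    ultimately show ?thesis
      using False assms card[of i] card[of j] disj
      by (simp add: edge_density_def card_edges_between of_nat_diff mult_mono field_simps power2_eq_square)
  qed
qed

lemma star_graph_no_triangle_at_0:
  assumes "{0, x} \<in> edges (star_graph m n a)" "{0, y} \<in> edges (star_graph m n a)"
  shows "{x, y} \<notin> edges (star_graph m n a)"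
  using assms by (auto simp: star_graph_edge_iff star_adj_def)

text \<open>The parts cover the graph and each contributes one vertex. The size bound later forces a
  copy of a graph on \<open>m\<close> vertices to fill the traversal.\<close>

lemma traversal_verts:
  assumes "multipartite m G V" "traversal m G V T"
  shows "finite (verts T)" "card (verts T) \<le> m" "\<And>i. i \<in> {1..m} \<Longrightarrow> verts T \<inter> V i \<noteq> {}"
proof -
  show fin: "finite (verts T)"
    using assms by (simp add: traversal_def subgraph_def simple_graph_def)
  show "verts T \<inter> V i \<noteq> {}" if "i \<in> {1..m}" for i
    using assms that by (fastforce simp: traversal_def)
  have "\<forall>i\<in>{1..m}. \<exists>v. verts T \<inter> V i = {v}"
    using assms(2) unfolding traversal_def by blast
  then obtain v where v: "\<And>i. i \<in> {1..m} \<Longrightarrow> verts T \<inter> V i = {v i}"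
    by metis
  have "verts T \<subseteq> v ` {1..m}"
  proof
    fix x assume x: "x \<in> verts T"
    then obtain i where "i \<in> {1..m}" "x \<in> V i"
      using assms by (auto simp: traversal_def subgraph_def multipartite_def)
    then show "x \<in> v ` {1..m}"
      using v[of i] x by auto
  qed
  then show "card (verts T) \<le> m"
    using surj_card_le[of "{1..m}" "verts T" v] by simp
qed

lemma star_graph_no_traversal:
  assumes "0 < n" "1 \<le> r"
  shows "\<not> has_traversal (3 * r) (star_graph (3 * r) n a) (star_part n)
    (disjoint_copies r (complete_graph 3))"
proof
  let ?G = "star_graph (3 * r) n a" and ?F = "disjoint_copies r (complete_graph 3)"
  assume "has_traversal (3 * r) ?G (star_part n) ?F"
  then obtain T H f where T: "traversal (3 * r) ?G (star_part n) T" and H: "subgraph H T"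
    and f: "bij_betw f (verts ?F) (verts H)" "(`) f ` edges ?F = edges H"
    by (auto simp: has_traversal_def contains_copy_def graph_iso_def)
  note T_verts = traversal_verts[OF multipartite_star_graph[OF assms(1)] T]
  have "card (verts H) = 3 * r"
    using bij_betw_same_card[OF f(1)]
    by (simp add: disjoint_copies_def complete_graph_def card_cartesian_product)
  \<comment> \<open>The copy has \<open>3 * r\<close> vertices, as many as the traversal can have,
    so it cannot omit 0, the only vertex of part 1. The other two vertices of the triangle at 0 then
    give the contradiction.\<close>
  then have "verts H = verts T"
    using H T_verts by (intro card_seteq) (auto simp: subgraph_def)
  moreover have "0 \<in> verts T"
    using T_verts(3)[of 1] assms by (simp add: star_part_1)
  ultimately have "0 \<in> f ` ({1..r} \<times> {1..3})"
    using f(1) by (simp add: bij_betw_def disjoint_copies_def complete_graph_def)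
  then obtain k j where kj: "k \<in> {1..r}" "j \<in> {1..3}" "f (k, j) = 0"
    by force
  have edge: "{f (k, p), f (k, q)} \<in> edges ?G" if "p \<in> {1..3}" "q \<in> {1..3}" "p \<noteq> q" for p q
  proof -
    have "{k} \<times> {p, q} \<in> edges ?F"
      using that kj unfolding disjoint_copies_def complete_graph_def
      by simp (rule exI[of _ k], rule exI[of _ "{p, q}"], simp)
    then have "f ` ({k} \<times> {p, q}) \<in> edges H"
      using f(2) by blast
    then show ?thesis
      using H T by (auto simp: subgraph_def traversal_def)
  qed
  obtain p q where "p \<in> {1..3}" "q \<in> {1..3}" "j \<noteq> p" "j \<noteq> q" "p \<noteq> q"
  proof -
    have "j = 1 \<or> j = 2 \<or> j = 3"
      using kj by auto
    then show thesis
      using that[of 2 3] that[of 1 3] that[of 1 2] by auto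
  qed
  then show False
    using star_graph_no_triangle_at_0[of "f (k, p)" "3 * r" n a "f (k, q)"] edge[of j p] edge[of j q]
      edge[of p q] kj by simp
qed


section \<open>The critical density\<close>

lemma critical_density_triangles:
  assumes "1 \<le> r"
  shows "critical_density (3 * r) (disjoint_copies r (complete_graph 3)) = inv_golden"
proof -
  define S where "S = {\<alpha> \<in> {0..1}. \<exists>(G :: nat ugraph) V. multipartite (3 * r) G V
    \<and> partite_density (3 * r) G V \<ge> \<alpha>
    \<and> \<not> has_traversal (3 * r) G V (disjoint_copies r (complete_graph 3))}"
  have upper: "\<alpha> \<le> inv_golden" if "\<alpha> \<in> S" for \<alpha>
    using that has_traversal_triangles_if_dense[of r] by (fastforce simp: S_def not_le)
  \<comment> \<open>The threshold is irrational, whereas the construction has rational densities;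
    rounding down with denominator \<open>n\<close> approaches it from below.\<close>
  have mem: "nat \<lfloor>inv_golden * n\<rfloor> / n \<in> S" if "0 < n" for n :: nat
  proof -
    define a where "a = nat \<lfloor>inv_golden * n\<rfloor>"
    have "real a \<le> inv_golden * n"
      using inv_golden_pos by (simp add: a_def)
    then have a_le: "a / n \<le> inv_golden"
      using that by (simp add: field_simps)
    then have "a / n \<le> 1"
      using inv_golden_less_1 by simp
    then have "a \<le> n"
      using that by (simp add: field_simps)
    have "(a / n)\<^sup>2 \<le> inv_golden\<^sup>2"
      using a_le by (intro power_mono) auto
    \<comment> \<open>At the threshold the two densities of the construction coincide. Below it the
      one at part 1 is the smaller.\<close>
    then have "a / n \<le> 1 - (a / n)\<^sup>2"
      using a_le inv_golden_square by (simp add: power2_eq_square)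
    then have "a / n \<le> partite_density (3 * r) (star_graph (3 * r) n a) (star_part n)"
      using assms that \<open>a \<le> n\<close> by (intro le_partite_density) (auto simp: edge_density_star_graph)
    then show ?thesis
      using multipartite_star_graph[OF that, of "3 * r" a] star_graph_no_traversal[OF that assms, of a]
        \<open>a / n \<le> 1\<close> unfolding a_def[symmetric] S_def by (intro CollectI conjI exI) auto
  qed
  \<comment> \<open>Rounding loses less than \<open>1 / n\<close>, so no smaller number bounds
    \<open>S\<close>.\<close>
  have "inv_golden \<le> b" if b: "\<And>\<alpha>. \<alpha> \<in> S \<Longrightarrow> \<alpha> \<le> b" for b
  proof (rule ccontr)
    assume "\<not> inv_golden \<le> b"
    then obtain n :: nat where n: "0 < n" "1 / n < inv_golden - b"
      using ex_inverse_of_nat_less[of "inv_golden - b"] by (auto simp: inverse_eq_divide)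
    have "inv_golden * n - 1 < nat \<lfloor>inv_golden * n\<rfloor>"
      using inv_golden_pos by linarith
    then have "(inv_golden * n - 1) / n < nat \<lfloor>inv_golden * n\<rfloor> / n"
      using n(1) by (simp add: divide_strict_right_mono)
    then have "inv_golden - 1 / n < nat \<lfloor>inv_golden * n\<rfloor> / n"
      using n(1) by (simp add: diff_divide_distrib)
    then show False
      using b[OF mem[OF n(1)]] n(2) by simp
  qed
  moreover have "S \<noteq> {}"
    using mem[of 1] by auto
  ultimately have "Sup S = inv_golden"
    using upper by (intro cSup_eq_non_empty) auto
  then show ?thesis
    by (simp add: critical_density_def S_def)
qed

section \<open>Isomorphism invariance, and one copy as the graph itself\<close>

lemma graph_iso_trans:
  assumes "graph_iso F G" "graph_iso G H"
  shows "graph_iso F H"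
proof -
  obtain f g where f: "bij_betw f (verts F) (verts G)" "(`) f ` edges F = edges G"
    and g: "bij_betw g (verts G) (verts H)" "(`) g ` edges G = edges H"
    using assms by (auto simp: graph_iso_def)
  have "(`) (g \<circ> f) ` edges F = (`) g ` (`) f ` edges F"
    by (simp add: image_image image_comp)
  then show ?thesis
    unfolding graph_iso_def using bij_betw_trans[OF f(1) g(1)] f(2) g(2)
    by (intro exI[of _ "g \<circ> f"]) simp
qed

text \<open>The forbidden graph enters only through \<open>contains_copy\<close>. By transitivity,
  each of the two isomorphisms yields one implication.\<close>

lemma critical_density_cong:
  assumes "graph_iso F F'" "graph_iso F' F"
  shows "critical_density m F = critical_density m F'"
proof -
  have "contains_copy G F \<longleftrightarrow> contains_copy G F'" for G :: "nat ugraph"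
    using graph_iso_trans[OF assms(1)] graph_iso_trans[OF assms(2)] unfolding contains_copy_def by blast
  then show ?thesis
    by (simp add: critical_density_def has_traversal_def)
qed

lemma disjoint_copies_1:
  "disjoint_copies 1 F = \<lparr>verts = {1} \<times> verts F, edges = (\<times>) {1} ` edges F\<rparr>"
  by (auto simp: disjoint_copies_def)

text \<open>The two graphs have different vertex types; \<open>snd\<close> and \<open>Pair 1\<close>
  are mutually inverse isomorphisms. This identifies the case \<open>r = 1\<close> with the plain
  triangle.\<close>

lemma critical_density_single_copy:
  "critical_density m (disjoint_copies 1 F) = critical_density m F"
proof (rule critical_density_cong)
  have "bij_betw snd ({1} \<times> verts F) (verts F)"
    by (auto simp: bij_betw_def inj_on_def)
  then show "graph_iso (disjoint_copies 1 F) F"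
    unfolding graph_iso_def disjoint_copies_1
    by (intro exI[of _ snd]) (simp add: image_image del: One_nat_def)
  have "bij_betw (Pair 1) (verts F) ({1} \<times> verts F)"
    by (auto simp: bij_betw_def inj_on_def)
  moreover have "Pair (1::nat) ` e = {1} \<times> e" for e :: "'a set"
    by auto
  ultimately show "graph_iso F (disjoint_copies 1 F)"
    unfolding graph_iso_def disjoint_copies_1
    by (intro exI[of _ "Pair 1"]) (simp del: One_nat_def)
qed

theorem mainTheorem5:
  fixes r :: nat
  assumes "r \<ge> 1"
  shows "critical_density (3 * r) (disjoint_copies r (complete_graph 3))
           = critical_density 3 (complete_graph 3)
       \<and> critical_density 3 (complete_graph 3) = (- 1 + sqrt 5) / 2"
  using critical_density_triangles[OF assms] critical_density_triangles[of 1]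
  by (simp add: critical_density_single_copy inv_golden_def del: One_nat_def)

end
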